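(* Let $n$ be a nonnegative integer and let $a_0,\dots,a_n$ be complex numbers with $\sum_{j=0}^n|a_j|>0$. (a) Given nonnegative integers $d_0<d_1<\dots<d_n$, the polynomial $P(z)=\sum_{j=0}^n a_jz^{d_j}$ has no $n$-deep zeros in $\mathbb{C}\setminus\{0\}$. (b) Given pairwise distinct complex numbers $\mu_0,\dots,\mu_n$, the function $Q(z)=\sum_{j=0}^n a_je^{\mu_jz}$ has no $n$-deep zeros in $\mathbb{C}$.
   Context: A zero $z_0$ of a holomorphic function $f$ is called $n$-deep if its multiplicity is at least $n+1$. *)

theory Defs
  imports "HOL-Complex_Analysis.Complex_Analysis"
begin

(* Intended for f holomorphic near z. The value of zorder is unspecified if f vanishes
   identically near z; such a point counts as a zero of infinite multiplicity. *)
definition deep_zero :: "nat \<Rightarrow> (complex \<Rightarrow> complex) \<Rightarrow> complex \<Rightarrow> bool" where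
  "deep_zero n f z \<longleftrightarrow>
     f z = 0 \<and> ((\<forall>\<^sub>F w in nhds z. f w = 0) \<or> zorder f z \<ge> int n + 1)"

end

theory Submission
  imports Defs
begin

text \<open>
  For exponential sums the argument is a complex form of Rolle's theorem. If
  \<open>Q(z) = \<Sum>a\<^sub>j exp (\<mu>\<^sub>j z)\<close> has \<open>m\<close> terms and vanishes to order \<open>m\<close> at a point, then for each index
  \<open>k\<close> the function \<open>Q' - \<mu>\<^sub>k Q\<close> vanishes there to order \<open>m - 1\<close> and is an exponential sum without
  the \<open>k\<close>-th term, whose coefficients are \<open>a\<^sub>j (\<mu>\<^sub>j - \<mu>\<^sub>k)\<close>. By induction these are zero, so
  \<open>a\<^sub>j = 0\<close> for all \<open>j \<noteq> k\<close>; what is left of \<open>Q\<close> is a single exponential term with a zero, so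
  \<open>a\<^sub>k = 0\<close> as well (lemma \<open>exp_sum_vanishing_coeffs_0\<close>).

  A polynomial becomes an exponential sum with frequencies \<open>d\<^sub>j\<close> after the substitution \<open>z = exp u\<close>.
  Every nonzero \<open>z\<close> has this form, and an analytic substitution does not lower the order of
  vanishing (lemma \<open>vanishes_to_order_compose\<close>), so the polynomial case follows.
\<close>

text \<open>
  Multiplicity at least \<open>m\<close>, expressed by a factorisation so that infinite multiplicity is included
  and no case distinction on the exact order arises under differentiation or composition.
\<close>

definition vanishes_to_order :: "nat \<Rightarrow> (complex \<Rightarrow> complex) \<Rightarrow> complex \<Rightarrow> bool" where
  "vanishes_to_order m f z \<longleftrightarrow>
     (\<exists>g. g analytic_on {z} \<and> (\<forall>\<^sub>F w in nhds z. f w = (w - z) ^ m * g w))"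

lemma deep_zero_imp_vanishes_to_order:
  assumes f: "f analytic_on {z}" and deep: "deep_zero n f z"
  shows "vanishes_to_order (Suc n) f z"
proof -
  obtain e where e: "e > 0" "f holomorphic_on ball z e"
    using f by (auto simp: analytic_at_ball)
  show ?thesis
  proof (cases "\<forall>\<^sub>F w in nhds z. f w = 0")
    case True
    then show ?thesis
      unfolding vanishes_to_order_def by (intro exI[of _ "\<lambda>_. 0"]) auto
  next
    case False
    have "\<exists>w\<in>ball z e. f w \<noteq> 0"
    proof (rule ccontr)
      assume "\<not> (\<exists>w\<in>ball z e. f w \<noteq> 0)"
      then have "\<forall>\<^sub>F w in nhds z. f w = 0"
        using e(1) by (intro eventually_nhds_in_open[THEN eventually_mono, of "ball z e"]) auto
      with False show False ..
    qed
    from zorder_exist_zero[OF e(2) _ _ _ this, of z] e(1)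
    obtain r where r: "r > 0" "zor_poly f z holomorphic_on cball z r"
      "\<And>w. w \<in> cball z r \<Longrightarrow> f w = zor_poly f z w * (w - z) ^ nat (zorder f z)"
      by (auto simp del: mem_cball)
    obtain k where k: "nat (zorder f z) = Suc n + k"
      using deep False unfolding deep_zero_def
      by (metis le_Suc_ex nat_int nat_mono of_nat_Suc add.commute)
    have "zor_poly f z analytic_on {z}"
      using r(1,2) ball_subset_cball holomorphic_on_subset unfolding analytic_at_ball by blast
    moreover have "\<forall>\<^sub>F w in nhds z. f w = (w - z) ^ Suc n * ((w - z) ^ k * zor_poly f z w)"
      using eventually_nhds_in_open[of "ball z r" z] r(1)
      by (auto elim!: eventually_mono simp: r(3) k power_add mult_ac)
    ultimately show ?thesis
      unfolding vanishes_to_order_def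
      by (intro exI[of _ "\<lambda>w. (w - z) ^ k * zor_poly f z w"]) (auto intro!: analytic_intros)
  qed
qed

lemma vanishes_to_order_zero:
  assumes "vanishes_to_order m f z" "m > 0"
  shows "f z = 0"
  using assms unfolding vanishes_to_order_def by (auto dest: eventually_nhds_x_imp_x)

text \<open>
  The factor \<open>w - \<phi> u\<close> turns into \<open>\<phi> v - \<phi> u\<close>, which is \<open>v - u\<close> times an analytic difference
  quotient.
\<close>

lemma vanishes_to_order_compose:
  assumes f: "vanishes_to_order m f (\<phi> u)" and \<phi>: "\<phi> analytic_on {u}"
  shows "vanishes_to_order m (\<lambda>v. f (\<phi> v)) u"
proof -
  obtain g where g: "g analytic_on {\<phi> u}" "\<forall>\<^sub>F w in nhds (\<phi> u). f w = (w - \<phi> u) ^ m * g w"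
    using f unfolding vanishes_to_order_def by auto
  define q where "q = (\<lambda>v. if v = u then deriv \<phi> u else (\<phi> v - \<phi> u) / (v - u))"
  have q: "q analytic_on {u}"
    using \<phi> pole_lemma_open[of \<phi> _ u] unfolding analytic_at q_def by blast
  have factor: "\<phi> v - \<phi> u = (v - u) * q v" for v
    by (simp add: q_def)
  have "filterlim \<phi> (nhds (\<phi> u)) (nhds u)"
    using analytic_at_imp_isCont[OF \<phi>] by (simp add: isCont_def tendsto_at_iff_tendsto_nhds)
  from eventually_compose_filterlim[OF g(2) this]
  have "\<forall>\<^sub>F v in nhds u. f (\<phi> v) = (v - u) ^ m * (q v ^ m * g (\<phi> v))"
    by (simp add: factor power_mult_distrib mult.assoc)
  moreover have "(\<lambda>v. g (\<phi> v)) analytic_on {u}"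
    using analytic_on_compose[OF \<phi>, of g] g(1) by (simp add: o_def)
  ultimately show ?thesis
    unfolding vanishes_to_order_def
    by (intro exI[of _ "\<lambda>v. q v ^ m * g (\<phi> v)"]) (auto intro!: analytic_intros q)
qed

text \<open>
  Differentiating \<open>(w - z) ^ Suc m * g w\<close> leaves a common factor \<open>(w - z) ^ m\<close>, with the cofactor
  \<open>h\<close> below. The factorisation holds in a whole neighbourhood, so it may be differentiated there.
\<close>

lemma vanishes_to_order_deriv_diff:
  assumes "vanishes_to_order (Suc m) f z"
  shows "vanishes_to_order m (\<lambda>w. deriv f w - c * f w) z"
proof -
  obtain g where g: "g analytic_on {z}" "\<forall>\<^sub>F w in nhds z. f w = (w - z) ^ Suc m * g w"
    using assms unfolding vanishes_to_order_def by auto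
  obtain S where S: "open S" "z \<in> S" "g holomorphic_on S"
    using g(1) by (auto simp: analytic_at)
  define h where "h = (\<lambda>w. of_nat (Suc m) * g w + (w - z) * (deriv g w - c * g w))"
  have "\<forall>\<^sub>F w in nhds z. w \<in> S"
    using S by (intro eventually_nhds_in_open)
  moreover have "\<forall>\<^sub>F w in nhds z. \<forall>\<^sub>F v in nhds w. f v = (v - z) ^ Suc m * g v"
    using g(2) by (simp add: eventually_eventually)
  ultimately have "\<forall>\<^sub>F w in nhds z. deriv f w - c * f w = (w - z) ^ m * h w"
  proof eventually_elim
    case (elim w)
    have "(g has_field_derivative deriv g w) (at w)"
      using S elim(1) by (intro holomorphic_derivI)
    then have "((\<lambda>v. (v - z) ^ Suc m * g v) has_field_derivative
        of_nat (Suc m) * (w - z) ^ m * g w + (w - z) ^ Suc m * deriv g w) (at w)"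
      by (auto intro!: derivative_eq_intros simp del: power_Suc)
    then have deriv_f:
      "deriv f w = of_nat (Suc m) * (w - z) ^ m * g w + (w - z) ^ Suc m * deriv g w"
      using deriv_cong_ev[OF elim(2) refl] by (simp add: DERIV_imp_deriv)
    have f: "f w = (w - z) ^ Suc m * g w"
      using elim(2) by (rule eventually_nhds_x_imp_x)
    show ?case
      unfolding deriv_f f h_def by (simp add: algebra_simps)
  qed
  moreover have "h analytic_on {z}"
    unfolding h_def by (intro analytic_intros g(1))
  ultimately show ?thesis
    unfolding vanishes_to_order_def by blast
qed

text \<open>
  Rolle-type induction: the operator \<open>Q \<mapsto> Q' - \<mu>\<^sub>k Q\<close> removes the term of index \<open>k\<close> and costs
  one order of vanishing.
\<close>

lemma exp_sum_vanishing_coeffs_0: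
  fixes a \<mu> :: "'i \<Rightarrow> complex"
  assumes "finite A" "inj_on \<mu> A"
    and "vanishes_to_order (card A) (\<lambda>w. \<Sum>j\<in>A. a j * exp (\<mu> j * w)) z"
    and "i \<in> A"
  shows "a i = 0"
  using assms
proof (induction A arbitrary: a i rule: finite_induct)
  case empty
  then show ?case by simp
next
  case (insert k A)
  let ?Q = "\<lambda>w. \<Sum>j\<in>insert k A. a j * exp (\<mu> j * w)"
  have deriv_Q: "deriv ?Q w = (\<Sum>j\<in>insert k A. a j * \<mu> j * exp (\<mu> j * w))" for w
    by (rule DERIV_imp_deriv) (auto intro!: derivative_eq_intros sum.cong)
  have "deriv ?Q w - \<mu> k * ?Q w = (\<Sum>j\<in>A. a j * (\<mu> j - \<mu> k) * exp (\<mu> j * w))" for w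
    unfolding deriv_Q using insert.hyps
    by (simp add: sum_distrib_left algebra_simps sum_subtractf)
  moreover have "vanishes_to_order (card A) (\<lambda>w. deriv ?Q w - \<mu> k * ?Q w) z"
    using insert.prems(2) insert.hyps by (intro vanishes_to_order_deriv_diff) simp
  ultimately have
    "vanishes_to_order (card A) (\<lambda>w. \<Sum>j\<in>A. a j * (\<mu> j - \<mu> k) * exp (\<mu> j * w)) z"
    by simp
  then have "a j * (\<mu> j - \<mu> k) = 0" if "j \<in> A" for j
    using insert.IH[of "\<lambda>j. a j * (\<mu> j - \<mu> k)" j] insert.prems(1) that by (simp add: inj_on_insert)
  moreover have "\<mu> j \<noteq> \<mu> k" if "j \<in> A" for j
    using insert.prems(1) insert.hyps that by (metis inj_on_def insertCI)
  ultimately have a_A: "a j = 0" if "j \<in> A" for j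
    using that by fastforce
  have "?Q z = 0"
    using insert.hyps by (intro vanishes_to_order_zero[OF insert.prems(2)]) simp
  then have "a k = 0"
    using insert.hyps a_A by simp
  then show ?case
    using a_A insert.prems(3) by auto
qed

theorem corollary1p1:
  fixes n :: nat and a :: "nat \<Rightarrow> complex"
  assumes "(\<Sum>j\<le>n. cmod (a j)) > 0"
  shows "(\<forall>d :: nat \<Rightarrow> nat. strict_mono_on {..n} d \<longrightarrow>
            \<not> (\<exists>z \<in> UNIV - {0}. deep_zero n (\<lambda>z. \<Sum>j\<le>n. a j * z ^ d j) z)) \<and>
         (\<forall>\<mu> :: nat \<Rightarrow> complex. inj_on \<mu> {..n} \<longrightarrow>
            \<not> (\<exists>z. deep_zero n (\<lambda>z. \<Sum>j\<le>n. a j * exp (\<mu> j * z)) z))"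
proof -
  have exp_sum: False
    if "inj_on \<mu> {..n}" "vanishes_to_order (Suc n) (\<lambda>w. \<Sum>j\<le>n. a j * exp (\<mu> j * w)) z" for \<mu> z
    using exp_sum_vanishing_coeffs_0[of "{..n}" \<mu> a z] that assms by simp
  show ?thesis
  proof (intro conjI allI impI notI)
    fix d :: "nat \<Rightarrow> nat"
    let ?P = "\<lambda>z. \<Sum>j\<le>n. a j * z ^ d j"
    assume d: "strict_mono_on {..n} d" and "\<exists>z \<in> UNIV - {0}. deep_zero n ?P z"
    then obtain z where z: "z \<noteq> 0" "deep_zero n ?P z"
      by auto
    obtain u where u: "z = exp u"
      using z(1) by (metis exp_Ln)
    have "vanishes_to_order (Suc n) ?P (exp u)"
      using z(2) unfolding u
      by (intro deep_zero_imp_vanishes_to_order) (auto intro!: analytic_intros)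
    then have "vanishes_to_order (Suc n) (\<lambda>v. ?P (exp v)) u"
      by (rule vanishes_to_order_compose) (auto intro!: analytic_intros)
    then have "vanishes_to_order (Suc n) (\<lambda>v. \<Sum>j\<le>n. a j * exp (of_nat (d j) * v)) u"
      by (simp add: exp_of_nat_mult)
    moreover have "inj_on (\<lambda>j. of_nat (d j) :: complex) {..n}"
      using strict_mono_on_imp_inj_on[OF d] by (auto simp: inj_on_def)
    ultimately show False
      using exp_sum by blast
  next
    fix \<mu> :: "nat \<Rightarrow> complex"
    let ?Q = "\<lambda>z. \<Sum>j\<le>n. a j * exp (\<mu> j * z)"
    assume \<mu>: "inj_on \<mu> {..n}" and "\<exists>z. deep_zero n ?Q z"
    then obtain z where "deep_zero n ?Q z"
      by auto
    then have "vanishes_to_order (Suc n) ?Q z"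
      by (intro deep_zero_imp_vanishes_to_order) (auto intro!: analytic_intros)
    with \<mu> show False
      using exp_sum by blast
  qed
qed

end
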